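(* Let $q\ge 1$ be an integer, let $T$ be an infinite $(q+1)$-homogeneous tree rooted at $o$, and let $\psi\colon T\to\mathbb{C}$ be a function. Let $0<p\le\infty$ and let $X$ be $\mathbb{T}_p$ or $\mathbb{T}_{p,0}$ or $C_c(T)$, equipped with $\|\cdot\|_p$. Then the following are equivalent: (a) $M_\psi$ is a bounded linear operator from $X$ to $X$; (b) $\psi$ is a bounded function on $T$, i.e. $\psi\in\mathbb{T}_\infty$.
   Context: A $(q+1)$-homogeneous tree is a connected graph without cycles in which every vertex has exactly $q+1$ neighbours; rooted means that a vertex $o$ (the root) is singled out. For a vertex $v$, $|v|$ is the number of edges in the unique path from $o$ to $v$; for $n\ge1$ there are $(q+1)q^{n-1}$ vertices with $|v|=n$. Functions on $T$ are functions on its vertices. $\mathbb{N}=\{1,2,\dots\}$, $\mathbb{N}_0=\mathbb{N}\cup\{0\}$. For $f\colon T\to\mathbb{C}$ and $n\in\mathbb{N}$, $M_p(n,f)=\left(\frac{1}{(q+1)q^{n-1}}\sum_{|v|=n}|f(v)|^p\right)^{1/p}$ if $0<p<\infty$, $M_\infty(n,f)=\max_{|v|=n}|f(v)|$, and $M_p(0,f)=|f(o)|$ for all $p\in(0,\infty]$. Put $\|f\|_p=\sup_{n\in\mathbb{N}_0}M_p(n,f)$, $\mathbb{T}_p=\{f\colon T\to\mathbb{C}:\|f\|_p<\infty\}$ and $\mathbb{T}_{p,0}=\{f\in\mathbb{T}_p:\lim_{n\to\infty}M_p(n,f)=0\}$. $C_c(T)$ is the set of all $f\colon T\to\mathbb{C}$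 such that $M_p(n,f)=0$ for all but finitely many $n$ (equivalently, finitely supported functions). The multiplication operator with symbol $\psi$ is $M_\psi f=\psi f$ (pointwise product). $M_\psi$ being a bounded linear operator from $X$ to $X$ means that $\psi f\in X$ for all $f\in X$ and there is a constant $C$ with $\|\psi f\|_p\le C\|f\|_p$ for all $f\in X$ (also when $0<p<1$, where $\|\cdot\|_p$ is only a quasi-norm). *)

theory Defs
  imports "HOL-Analysis.Analysis" "Graph_Theory.Digraph_Component"
begin

text \<open>
  An undirected simple graph is a symmetric digraph without loops and parallel arcs, not
  necessarily finite. In this encoding every edge \<open>{u, v}\<close> yields the directed cycle \<open>u, v, u\<close>
  of length 2, so being a tree in the undirected sense means that there are no directed cycles
  of length at least 3 (and the library predicate \<^const>\<open>tree\<close>, which forbids all directed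
  cycles, is not the right one).
\<close>

locale homogeneous_tree =
  sym_digraph G + loopfree_digraph G + nomulti_digraph G
  for G :: "('v, 'e) pre_digraph" (structure) and q :: nat +
  assumes tree_connected: "Digraph_Component.connected G"
    and tree_no_cycles: "\<not> (\<exists>c. cycle c \<and> 3 \<le> length c)"
    and tree_degree: "v \<in> verts G \<Longrightarrow> out_degree G v = q + 1"

definition depth :: "('v, 'e) pre_digraph \<Rightarrow> 'v \<Rightarrow> 'v \<Rightarrow> nat" where
  "depth G r v = length (THE p. pre_digraph.apath G r p v)"

definition level :: "('v, 'e) pre_digraph \<Rightarrow> 'v \<Rightarrow> nat \<Rightarrow> 'v set" where
  "level G r n = {v \<in> verts G. depth G r v = n}"

text \<open>
  Functions on the tree are total functions on the vertex type; none of the notions below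
  depends on their values outside \<^term>\<open>verts G\<close>. The exponent \<open>p\<close> ranges over the extended
  nonnegative reals, and only \<open>p > 0\<close> is meaningful.
\<close>

definition tree_mean ::
    "('v, 'e) pre_digraph \<Rightarrow> nat \<Rightarrow> 'v \<Rightarrow> ennreal \<Rightarrow> nat \<Rightarrow> ('v \<Rightarrow> complex) \<Rightarrow> real" where
  "tree_mean G q r p n f =
    (if n = 0 then cmod (f r)
     else if p = \<infinity> then Max ((\<lambda>v. cmod (f v)) ` level G r n)
     else (1 / (real (q + 1) * real q ^ (n - 1))
             * (\<Sum>v\<in>level G r n. cmod (f v) powr enn2real p)) powr (1 / enn2real p))"

definition tree_norm ::
    "('v, 'e) pre_digraph \<Rightarrow> nat \<Rightarrow> 'v \<Rightarrow> ennreal \<Rightarrow> ('v \<Rightarrow> complex) \<Rightarrow> ennreal" where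
  "tree_norm G q r p f = (SUP n. ennreal (tree_mean G q r p n f))"

definition T_space ::
    "('v, 'e) pre_digraph \<Rightarrow> nat \<Rightarrow> 'v \<Rightarrow> ennreal \<Rightarrow> ('v \<Rightarrow> complex) set" where
  "T_space G q r p = {f. tree_norm G q r p f < \<infinity>}"

definition T0_space ::
    "('v, 'e) pre_digraph \<Rightarrow> nat \<Rightarrow> 'v \<Rightarrow> ennreal \<Rightarrow> ('v \<Rightarrow> complex) set" where
  "T0_space G q r p = {f \<in> T_space G q r p. (\<lambda>n. tree_mean G q r p n f) \<longlonglongrightarrow> 0}"

text \<open>The following set does not depend on \<open>p > 0\<close>.\<close>

definition Cc_space ::
    "('v, 'e) pre_digraph \<Rightarrow> nat \<Rightarrow> 'v \<Rightarrow> ennreal \<Rightarrow> ('v \<Rightarrow> complex) set" where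
  "Cc_space G q r p = {f. finite {n. tree_mean G q r p n f \<noteq> 0}}"

definition mult_op :: "('v \<Rightarrow> complex) \<Rightarrow> ('v \<Rightarrow> complex) \<Rightarrow> 'v \<Rightarrow> complex" where
  "mult_op \<psi> f = (\<lambda>v. \<psi> v * f v)"

text \<open>
  Boundedness of an operator from \<open>X\<close> to \<open>X\<close> for a (quasi-)norm \<open>N\<close>. Linearity is not part of the
  definition; it is automatic for \<^const>\<open>mult_op\<close>.
\<close>

definition bounded_operator_on ::
    "('v \<Rightarrow> complex) set \<Rightarrow> (('v \<Rightarrow> complex) \<Rightarrow> ennreal) \<Rightarrow>
     (('v \<Rightarrow> complex) \<Rightarrow> ('v \<Rightarrow> complex)) \<Rightarrow> bool" where
  "bounded_operator_on X N A \<longleftrightarrow>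
    (\<forall>f\<in>X. A f \<in> X) \<and> (\<exists>C::real. \<forall>f\<in>X. N (A f) \<le> ennreal C * N f)"

end

theory Submission
  imports Defs
begin

text \<open>
  If \<open>\<psi>\<close> is bounded by \<open>C\<close>, then \<open>\<psi> f\<close> is dominated by \<open>C f\<close> and all means are monotone and
  homogeneous. Conversely, the indicator function of a vertex \<open>v\<close> lies in all three spaces, has a
  nonzero finite norm, and is an eigenvector of the multiplication operator with eigenvalue
  \<open>\<psi> v\<close>, so the bound of the operator also bounds \<open>\<psi>\<close>. What needs work is the tree: paths are unique
  (otherwise there would be a cycle of length at least 3), hence depths are meaningful, and every
  level is finite and nonempty.
\<close>

section \<open>Levels of a homogeneous tree\<close>

text \<open>Symmetry supplies an opposite for every arc, so a walk can be run backwards. The vertex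
  set is tracked because the uniqueness proof needs the reversed walk to avoid a given
  vertex.\<close>

lemma (in sym_digraph) awalk_reverse:
  assumes "awalk u p v"
  shows "\<exists>p'. awalk v p' u \<and> set (awalk_verts v p') = set (awalk_verts u p)"
  using assms
proof (induction p arbitrary: u)
  case Nil
  then show ?case by (auto simp: awalk_Nil_iff intro!: exI[of _ "[]"])
next
  case (Cons e p)
  then have e: "e \<in> arcs G" "u = tail G e" "awalk (head G e) p v"
    by (auto simp: awalk_Cons_iff)
  obtain p' where p': "awalk v p' (head G e)"
    "set (awalk_verts v p') = set (awalk_verts (head G e) p)"
    using Cons.IH e(3) by blast
  obtain e' where e': "e' \<in> arcs G" "tail G e' = head G e" "head G e' = tail G e"
    using sym_arcs e(1) unfolding symmetric_conv by metis
  have "awalk v (p' @ [e']) u"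
    using p' e e' by (auto simp: awalk_simps)
  moreover have "set (awalk_verts v (p' @ [e'])) = set (awalk_verts u (e # p))"
    using awalk_verts_append[OF calculation] p' e e' by auto
  ultimately show ?case by blast
qed

section \<open>Uniqueness of simple paths\<close>

context homogeneous_tree
begin

text \<open>Leaving \<open>tail G e\<close> by \<open>e\<close>, following \<open>p\<close> and
  returning by \<open>e'\<close> closes a cycle. If \<open>w\<close> and \<open>w'\<close> differ,
  \<open>p\<close> is nonempty and the cycle has at least 3 arcs, which a tree forbids.\<close>

lemma apath_avoiding_neighbours:
  assumes p: "apath w p w'"
    and e: "e \<in> arcs G" "head G e = w"
    and e': "e' \<in> arcs G" "tail G e' = w'" "head G e' = tail G e"
    and avoid: "tail G e \<notin> set (awalk_verts w p)"
  shows "w = w'"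
proof (rule ccontr)
  assume "w \<noteq> w'"
  have w': "awalk w p w'" "awlast w p = w'" "distinct (awalk_verts w p)"
    using p by (auto simp: apath_def)
  have "awalk w (p @ [e']) (tail G e)"
    using w' e' tail_in_verts[OF e(1)] by (auto simp: awalk_simps)
  moreover from awalk_verts_append[OF this]
  have "awalk_verts w (p @ [e']) = awalk_verts w p @ [tail G e]"
    using w' e' by simp
  ultimately have "cycle (e # p @ [e'])"
    unfolding cycle_def using e w' avoid
    by (intro exI[of _ "tail G e"]) (auto simp: awalk_Cons_iff)
  moreover have "3 \<le> length (e # p @ [e'])"
    using p \<open>w \<noteq> w'\<close> by (cases p) (auto simp: apath_Nil_iff)
  ultimately show False using tree_no_cycles by blast
qed

text \<open>Paths that start with arcs \<open>e\<close> and \<open>e'\<close> both end at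
  \<open>v\<close>, so one remainder followed by the reverse of the other joins the two heads while
  avoiding \<open>u\<close>. The previous lemma then makes the heads equal, absence of parallel arcs
  the arcs themselves, and induction the remainders.\<close>

lemma apath_unique:
  assumes "apath u p v" "apath u p' v"
  shows "p = p'"
  using assms
proof (induction p arbitrary: u p')
  case Nil
  then show ?case using apath_nonempty_ends[of u p' v] by (auto simp: apath_Nil_iff)
next
  case (Cons e p)
  have "p' \<noteq> []"
    using Cons.prems apath_nonempty_ends[OF Cons.prems(1)] by (auto simp: apath_Nil_iff)
  then obtain e' q where p': "p' = e' # q" by (cases p') auto
  have e: "e \<in> arcs G" "tail G e = u" "apath (head G e) p v"
    "u \<notin> set (awalk_verts (head G e) p)"
    using Cons.prems(1) by (auto simp: apath_Cons_iff)
  have e': "e' \<in> arcs G" "tail G e' = u" "apath (head G e') q v"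
    "u \<notin> set (awalk_verts (head G e') q)"
    using Cons.prems(2) unfolding p' by (auto simp: apath_Cons_iff)
  obtain q' where q': "awalk v q' (head G e')"
    "set (awalk_verts v q') = set (awalk_verts (head G e') q)"
    using awalk_reverse e'(3) by (meson awalkI_apath)
  have walk: "awalk (head G e) (p @ q') (head G e')"
    using awalk_appendI[OF awalkI_apath[OF e(3)] q'(1)] .
  \<comment> \<open>The joined walk may repeat vertices, but the cycle argument needs a simple path;
    shortening only discards arcs, so no new vertex appears.\<close>
  define s where "s = awalk_to_apath (p @ q')"
  have s: "apath (head G e) s (head G e')"
    unfolding s_def using walk by (rule apath_awalk_to_apath)
  have "set (awalk_verts (head G e) s) \<subseteq> set (awalk_verts (head G e) (p @ q'))"
    unfolding set_awalk_verts[OF walk] set_awalk_verts[OF awalkI_apath[OF s]]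
    using awalk_to_apath_subset[OF walk] by (fold s_def) (simp, blast)
  also have "\<dots> \<subseteq> set (awalk_verts (head G e) p) \<union> set (awalk_verts v q')"
  proof -
    have "awlast (head G e) p = v" using e(3) by (auto simp: apath_def)
    then show ?thesis
      unfolding awalk_verts_append[OF walk] by (cases "awalk_verts v q'") auto
  qed
  finally have avoid: "tail G e \<notin> set (awalk_verts (head G e) s)"
    using e(2,4) e'(4) q'(2) by blast
  obtain f where f: "f \<in> arcs G" "tail G f = head G e'" "head G f = tail G e'"
    using sym_arcs e'(1) unfolding symmetric_conv by metis
  have "head G e = head G e'"
    by (rule apath_avoiding_neighbours[OF s e(1) refl f(1,2) _ avoid]) (simp add: f e e')
  then have "e = e'"
    using no_multi_arcs[of e e'] e(1,2) e'(1,2) by (simp add: arc_to_ends_def)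
  with Cons.IH[OF e(3)] e'(3) p' show ?case by simp
qed

section \<open>Depths and levels\<close>

lemma depth_eq_length:
  assumes "apath u p v"
  shows "depth G u v = length p"
proof -
  \<comment> \<open>Uniqueness lets the definite description in \<open>depth\<close> be evaluated at
    any path that is exhibited.\<close>
  have "(THE p. apath u p v) = p"
    using assms apath_unique by blast
  then show ?thesis by (simp add: depth_def)
qed

lemma apath_exists:
  assumes "u \<in> verts G" "v \<in> verts G"
  obtains p where "apath u p v"
  using symmetric_connected_imp_strongly_connected[OF sym_arcs tree_connected] assms
  by (auto simp: strongly_connected_def reachable_apath)

lemma finite_out_arcs_tree: "v \<in> verts G \<Longrightarrow> finite (out_arcs G v)"
  \<comment> \<open>\<open>card\<close> of an infinite set is 0, so the positive degree
    \<open>q + 1\<close> forces finiteness.\<close>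
  using tree_degree[of v] by (intro card_ge_0_finite) (simp add: out_degree_def)

lemma level_0:
  assumes "u \<in> verts G"
  shows "level G u 0 = {u}"
proof -
  have "depth G u v = 0 \<longleftrightarrow> v = u" if v: "v \<in> verts G" for v
  proof -
    obtain p where p: "apath u p v" using apath_exists assms v by blast
    then show ?thesis
      using depth_eq_length[OF p] apath_nonempty_ends[OF p] by (auto simp: apath_Nil_iff)
  qed
  then show ?thesis using assms by (auto simp: level_def)
qed

text \<open>Deleting the last arc of the path to a vertex leaves the path to its predecessor, one
  arc shorter. Finiteness and emptiness of a level thus pass to the next one.\<close>

lemma level_Suc_subset:
  assumes "u \<in> verts G"
  shows "level G u (Suc n) \<subseteq> (\<Union>w\<in>level G u n. head G ` out_arcs G w)"
proof
  fix v assume "v \<in> level G u (Suc n)"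
  then have v: "v \<in> verts G" "depth G u v = Suc n" by (auto simp: level_def)
  obtain p where p: "apath u p v" using apath_exists assms v(1) by blast
  then have "length p = Suc n" using v(2) depth_eq_length by simp
  then obtain q e where q: "p = q @ [e]" "length q = n"
    by (cases p rule: rev_cases) auto
  have q': "apath u q (tail G e)" and e: "e \<in> arcs G" "head G e = v"
    using p unfolding q(1) by (auto simp: apath_append_iff apath_simps)
  have "tail G e \<in> level G u n"
    using depth_eq_length[OF q'] q(2) e(1) by (simp add: level_def)
  moreover have "v \<in> head G ` out_arcs G (tail G e)"
    using e by (intro rev_image_eqI[of e]) auto
  ultimately show "v \<in> (\<Union>w\<in>level G u n. head G ` out_arcs G w)" by blast
qed

lemma finite_level:
  assumes "u \<in> verts G"
  shows "finite (level G u n)"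
proof (induction n)
  case 0
  then show ?case using assms by (simp add: level_0)
next
  case (Suc n)
  moreover have "finite (out_arcs G w)" if "w \<in> level G u n" for w
    using that finite_out_arcs_tree by (simp add: level_def)
  ultimately show ?case using finite_subset[OF level_Suc_subset[OF assms]] by blast
qed

text \<open>Beyond an empty level all levels are empty, so the tree would be a finite union of
  finite levels. Nonemptiness gives \<open>Max\<close> in the mean its meaning.\<close>

lemma level_nonempty:
  assumes "u \<in> verts G" "infinite (verts G)"
  shows "level G u n \<noteq> {}"
proof
  assume empty: "level G u n = {}"
  have "level G u (n + k) = {}" for k
  proof (induction k)
    case (Suc k)
    then show ?case using level_Suc_subset[OF assms(1), of "n + k"] by simp
  qed (simp add: empty)
  then have "level G u m = {}" if "n \<le> m" for m
    using that le_Suc_ex by blast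
  then have "depth G u v < n" if "v \<in> verts G" for v
    using that by (auto simp: level_def simp flip: not_le)
  then have "verts G \<subseteq> (\<Union>k<n. level G u k)" by (auto simp: level_def)
  then show False
    using assms(2) finite_level[OF assms(1)] by (meson finite_UN_I finite_lessThan finite_subset)
qed

end

section \<open>Means and norms\<close>

locale rooted_homogeneous_tree = homogeneous_tree +
  fixes r :: 'a
  assumes root: "r \<in> verts G"
    and infinite_verts: "infinite (verts G)"
    and degree_ge_1: "1 \<le> q"
begin

text \<open>For finite exponents \<open>C\<close> enters the sum as \<open>C powr P\<close> and
  leaves through the root; from a maximum it comes out directly. Only monotonicity and homogeneity
  are involved, so exponents below 1 are covered as well.\<close>

lemma tree_mean_le:
  assumes "0 \<le> C" and le: "\<And>v. v \<in> verts G \<Longrightarrow> cmod (g v) \<le> C * cmod (f v)" and "0 < p"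
  shows "tree_mean G q r p n g \<le> C * tree_mean G q r p n f"
proof -
  have fin: "finite (level G r n)" and ne: "level G r n \<noteq> {}"
    using finite_level level_nonempty root infinite_verts by auto
  have le': "cmod (g v) \<le> C * cmod (f v)" if "v \<in> level G r n" for v
    using that le by (simp add: level_def)
  consider "n = 0" | "n \<noteq> 0" "p = \<infinity>" | "n \<noteq> 0" "p \<noteq> \<infinity>" by blast
  then show ?thesis
  proof cases
    case 1
    then show ?thesis using le root by (simp add: tree_mean_def)
  next
    case 2
    have "cmod (g v) \<le> C * Max ((\<lambda>v. cmod (f v)) ` level G r n)" if "v \<in> level G r n" for v
    proof -
      have "cmod (f v) \<le> Max ((\<lambda>v. cmod (f v)) ` level G r n)"
        using fin that by simp
      then show ?thesis
        using le'[OF that] \<open>0 \<le> C\<close> mult_left_mono order_trans by blast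
    qed
    then show ?thesis using 2 fin ne by (simp add: tree_mean_def)
  next
    case 3
    define P where "P = enn2real p"
    define N where "N = 1 / (real (q + 1) * real q ^ (n - 1))"
    define S where "S = (\<Sum>v\<in>level G r n. cmod (f v) powr P)"
    \<comment> \<open>\<open>enn2real\<close> sends infinity to 0, so positivity of \<open>P\<close>
      rests on finiteness of \<open>p\<close> as well as on \<open>0 < p\<close>.\<close>
    have P: "0 < P"
      using 3 \<open>0 < p\<close> by (simp add: P_def enn2real_positive_iff less_top)
    have N: "0 \<le> N" and S: "0 \<le> S" by (auto simp: N_def S_def sum_nonneg)
    have "(\<Sum>v\<in>level G r n. cmod (g v) powr P) \<le> (\<Sum>v\<in>level G r n. C powr P * cmod (f v) powr P)"
      using le' P \<open>0 \<le> C\<close> by (intro sum_mono) (metis norm_ge_zero powr_mono2 powr_mult less_imp_le)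
    also have "\<dots> = C powr P * S" by (simp add: S_def sum_distrib_left)
    finally have "N * (\<Sum>v\<in>level G r n. cmod (g v) powr P) \<le> C powr P * (N * S)"
      using N by (metis mult.left_commute mult_left_mono)
    then have "(N * (\<Sum>v\<in>level G r n. cmod (g v) powr P)) powr (1 / P)
        \<le> (C powr P * (N * S)) powr (1 / P)"
      using N P by (intro powr_mono2) (auto intro!: mult_nonneg_nonneg sum_nonneg)
    also have "\<dots> = C * (N * S) powr (1 / P)"
      using N P S \<open>0 \<le> C\<close> by (simp add: powr_mult powr_powr)
    finally show ?thesis
      using 3 by (simp add: tree_mean_def P_def N_def S_def)
  qed
qed

lemma tree_mean_eq_0_iff:
  assumes "0 < p"
  shows "tree_mean G q r p n f = 0 \<longleftrightarrow> (\<forall>v\<in>level G r n. f v = 0)"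
proof -
  have fin: "finite (level G r n)" and ne: "level G r n \<noteq> {}"
    using finite_level level_nonempty root infinite_verts by auto
  consider "n = 0" | "n \<noteq> 0" "p = \<infinity>" | "n \<noteq> 0" "p \<noteq> \<infinity>" by blast
  then show ?thesis
  proof cases
    case 1
    then show ?thesis by (simp add: tree_mean_def level_0 root)
  next
    case 2
    have "Max ((\<lambda>v. cmod (f v)) ` level G r n) = 0 \<longleftrightarrow> (\<forall>v\<in>level G r n. f v = 0)"
      using fin ne by (subst Max_eq_iff) (auto simp: image_iff)
    then show ?thesis using 2 by (simp add: tree_mean_def)
  next
    case 3
    \<comment> \<open>\<open>degree_ge_1\<close> makes the weight positive; for \<open>q = 0\<close>
      and \<open>n > 1\<close> it would be \<open>1 / 0 = 0\<close> and the mean would vanish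
      identically.\<close>
    then show ?thesis
      using fin degree_ge_1 by (simp add: tree_mean_def sum_nonneg_eq_0_iff)
  qed
qed

lemma tree_mean_nonneg: "0 \<le> tree_mean G q r p n f"
proof -
  have "finite (level G r n)" "level G r n \<noteq> {}"
    using finite_level level_nonempty root infinite_verts by auto
  then have "0 \<le> Max ((\<lambda>v. cmod (f v)) ` level G r n)"
    by (subst Max_ge_iff) auto
  then show ?thesis by (simp add: tree_mean_def)
qed

section \<open>The norm and the three spaces\<close>

lemma tree_norm_le:
  assumes "0 \<le> C" "\<And>v. v \<in> verts G \<Longrightarrow> cmod (g v) \<le> C * cmod (f v)" "0 < p"
  shows "tree_norm G q r p g \<le> ennreal C * tree_norm G q r p f"
  unfolding tree_norm_def
proof (rule SUP_least)
  fix n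
  have "ennreal (tree_mean G q r p n g) \<le> ennreal C * ennreal (tree_mean G q r p n f)"
    using tree_mean_le[OF assms] assms(1) tree_mean_nonneg
    by (simp add: ennreal_mult[symmetric] ennreal_leI)
  also have "\<dots> \<le> ennreal C * (SUP n. ennreal (tree_mean G q r p n f))"
    by (intro mult_left_mono SUP_upper) auto
  finally show "ennreal (tree_mean G q r p n g) \<le> \<dots>" .
qed

text \<open>Means that are eventually 0 tend to 0, and a convergent sequence is bounded, so the
  supremum is finite. This places the test functions in every choice of \<open>X\<close>.\<close>

lemma Cc_space_subset_T0_space: "Cc_space G q r p \<subseteq> T0_space G q r p"
proof
  fix f assume "f \<in> Cc_space G q r p"
  then have fin: "finite {n. tree_mean G q r p n f \<noteq> 0}" by (simp add: Cc_space_def)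
  have "\<forall>\<^sub>F n in sequentially. tree_mean G q r p n f = 0"
    using fin by (simp add: eventually_cofinite[symmetric] cofinite_eq_sequentially)
  then have lim: "(\<lambda>n. tree_mean G q r p n f) \<longlonglongrightarrow> 0" by (rule tendsto_eventually)
  then obtain B where "tree_mean G q r p n f \<le> B" for n
    using convergent_imp_Bseq[OF convergentI] by (metis Bseq_def real_norm_def abs_le_D1)
  then have "tree_norm G q r p f \<le> ennreal B"
    unfolding tree_norm_def by (intro SUP_least ennreal_leI)
  also have "\<dots> < \<infinity>" by simp
  finally have "tree_norm G q r p f < \<infinity>" .
  with lim show "f \<in> T0_space G q r p" by (simp add: T0_space_def T_space_def)
qed

text \<open>Domination bounds the norm, squeezes the means to 0 and preserves their zeros, which
  settles the three spaces in turn.\<close>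

lemma mem_spaces_dominated:
  assumes "0 \<le> C" "\<And>v. v \<in> verts G \<Longrightarrow> cmod (g v) \<le> C * cmod (f v)" "0 < p"
    and X: "X = T_space G q r p \<or> X = T0_space G q r p \<or> X = Cc_space G q r p"
    and "f \<in> X"
  shows "g \<in> X"
proof -
  have mean: "tree_mean G q r p n g \<le> C * tree_mean G q r p n f" for n
    using assms by (intro tree_mean_le)
  have T: "g \<in> T_space G q r p" if "f \<in> T_space G q r p"
  proof -
    have "tree_norm G q r p g \<le> ennreal C * tree_norm G q r p f"
      using assms by (intro tree_norm_le)
    also have "\<dots> < \<infinity>"
      using that by (simp add: T_space_def ennreal_mult_less_top)
    finally show ?thesis by (simp add: T_space_def)
  qed
  have T0: "(\<lambda>n. tree_mean G q r p n g) \<longlonglongrightarrow> 0"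
    if lim: "(\<lambda>n. tree_mean G q r p n f) \<longlonglongrightarrow> 0"
  proof (rule tendsto_sandwich[OF _ _ tendsto_const])
    show "(\<lambda>n. C * tree_mean G q r p n f) \<longlonglongrightarrow> 0"
      using tendsto_mult_left[OF lim, of C] by simp
  qed (auto simp: tree_mean_nonneg mean)
  have "tree_mean G q r p n g = 0" if "tree_mean G q r p n f = 0" for n
    using mean[of n] tree_mean_nonneg[of p n g] that by simp
  then have Cc: "{n. tree_mean G q r p n g \<noteq> 0} \<subseteq> {n. tree_mean G q r p n f \<noteq> 0}"
    by auto
  show ?thesis
    using X \<open>f \<in> X\<close> T T0 finite_subset[OF Cc] by (auto simp: T0_space_def Cc_space_def)
qed

section \<open>Test functions and the boundedness criterion\<close>

lemma vertex_indicator: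
  fixes v :: 'a
  defines "\<delta> \<equiv> (\<lambda>w. if w = v then 1 else 0 :: complex)"
  assumes "v \<in> verts G" "0 < p"
  shows "\<delta> \<in> Cc_space G q r p" "tree_norm G q r p \<delta> \<noteq> 0"
proof -
  \<comment> \<open>Only the level containing \<open>v\<close> sees the indicator, so exactly one
    mean is nonzero.\<close>
  have supp: "tree_mean G q r p n \<delta> \<noteq> 0 \<longleftrightarrow> n = depth G r v" for n
    using assms by (auto simp: tree_mean_eq_0_iff level_def)
  then show "\<delta> \<in> Cc_space G q r p" by (simp add: Cc_space_def)
  have "0 < ennreal (tree_mean G q r p (depth G r v) \<delta>)"
    using supp tree_mean_nonneg by (simp add: less_le)
  also have "\<dots> \<le> tree_norm G q r p \<delta>"
    unfolding tree_norm_def by (rule SUP_upper) simp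
  finally show "tree_norm G q r p \<delta> \<noteq> 0" by simp
qed

lemma bounded_operator_mult_op_iff:
  assumes "0 < p"
    and X: "X = T_space G q r p \<or> X = T0_space G q r p \<or> X = Cc_space G q r p"
  shows "bounded_operator_on X (tree_norm G q r p) (mult_op \<psi>) \<longleftrightarrow> bounded (\<psi> ` verts G)"
proof
  assume "bounded_operator_on X (tree_norm G q r p) (mult_op \<psi>)"
  then obtain C :: real where
    C: "\<And>f. f \<in> X \<Longrightarrow> tree_norm G q r p (mult_op \<psi> f) \<le> ennreal C * tree_norm G q r p f"
    by (auto simp: bounded_operator_on_def)
  \<comment> \<open>The operator constant may be negative, in which case \<open>ennreal C\<close> is
    0; hence \<open>max C 0\<close>.\<close>
  have "cmod (\<psi> v) \<le> max C 0" if v: "v \<in> verts G" for v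
  proof (cases "\<psi> v = 0")
    case False
    define \<delta> where "\<delta> = (\<lambda>w. if w = v then 1 else 0 :: complex)"
    have \<delta>: "\<delta> \<in> Cc_space G q r p" "tree_norm G q r p \<delta> \<noteq> 0"
      unfolding \<delta>_def using vertex_indicator v \<open>0 < p\<close> by auto
    have "\<delta> \<in> T0_space G q r p" using \<delta>(1) Cc_space_subset_T0_space by blast
    then have "\<delta> \<in> X" and fin: "tree_norm G q r p \<delta> < \<infinity>"
      using X \<delta>(1) by (auto simp: T0_space_def T_space_def)
    \<comment> \<open>Domination is used backwards here: since \<psi> does not vanish at
      \<open>v\<close>, the indicator is \<open>1 / \<psi> v\<close> times its image under the
      operator.\<close>
    have "tree_norm G q r p \<delta> \<le> ennreal (1 / cmod (\<psi> v)) * tree_norm G q r p (mult_op \<psi> \<delta>)"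
      using \<open>0 < p\<close> False by (intro tree_norm_le) (auto simp: \<delta>_def mult_op_def norm_mult)
    also have "\<dots> \<le> ennreal (1 / cmod (\<psi> v)) * (ennreal C * tree_norm G q r p \<delta>)"
      using C[OF \<open>\<delta> \<in> X\<close>] by (intro mult_left_mono) auto
    finally have "tree_norm G q r p \<delta> \<le> ennreal (1 / cmod (\<psi> v)) * (ennreal C * tree_norm G q r p \<delta>)" .
    \<comment> \<open>A finite nonzero norm is a positive real, so it can be cancelled.\<close>
    moreover obtain N where "tree_norm G q r p \<delta> = ennreal N" "0 < N"
      using fin \<delta>(2) by (cases "tree_norm G q r p \<delta>") (auto simp: less_le)
    moreover have "ennreal C = ennreal (max C 0)" by (simp add: ennreal_neg max_def)
    ultimately have "N \<le> 1 / cmod (\<psi> v) * (max C 0 * N)"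
      by (simp add: ennreal_mult[symmetric])
    then show ?thesis using False \<open>0 < N\<close> by (simp add: field_simps)
  qed simp
  then show "bounded (\<psi> ` verts G)" unfolding bounded_iff by blast
next
  assume "bounded (\<psi> ` verts G)"
  then obtain C where C: "0 < C" "\<And>v. v \<in> verts G \<Longrightarrow> cmod (\<psi> v) \<le> C"
    unfolding bounded_pos by auto
  then have le: "cmod (mult_op \<psi> f v) \<le> C * cmod (f v)" if "v \<in> verts G" for f v
    using that by (simp add: mult_op_def norm_mult mult_right_mono)
  have "mult_op \<psi> f \<in> X" if "f \<in> X" for f
    using C(1) le X that \<open>0 < p\<close> by (intro mem_spaces_dominated[of C "mult_op \<psi> f" f p X]) auto
  moreover have "tree_norm G q r p (mult_op \<psi> f) \<le> ennreal C * tree_norm G q r p f" for f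
    using C(1) le \<open>0 < p\<close> by (intro tree_norm_le) auto
  ultimately show "bounded_operator_on X (tree_norm G q r p) (mult_op \<psi>)"
    unfolding bounded_operator_on_def by blast
qed

section \<open>Bounded symbols and the infinite exponent\<close>

lemma cmod_le_tree_mean_infinity:
  assumes "v \<in> verts G"
  shows "cmod (f v) \<le> tree_mean G q r \<infinity> (depth G r v) f"
proof (cases "depth G r v = 0")
  \<comment> \<open>The mean at level 0 is evaluated at the root, so \<open>v\<close> first has to
    be identified with \<open>r\<close>.\<close>
  case True
  then have "v \<in> level G r 0" using assms by (simp add: level_def)
  then show ?thesis using True root by (simp add: level_0 tree_mean_def)
next
  case False
  then show ?thesis
    using assms finite_level[OF root] by (auto simp: tree_mean_def level_def intro!: Max_ge)
qed

text \<open>A symbol bounded by \<open>C\<close> is dominated by \<open>C\<close> times the constant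
  1, which has norm 1. Conversely, each value is at most the maximum over its level.\<close>

lemma bounded_iff_T_space_infinity:
  "bounded (\<psi> ` verts G) \<longleftrightarrow> \<psi> \<in> T_space G q r \<infinity>"
proof
  assume "bounded (\<psi> ` verts G)"
  then obtain C where C: "0 < C" "\<And>v. v \<in> verts G \<Longrightarrow> cmod (\<psi> v) \<le> C"
    unfolding bounded_pos by auto
  have one: "tree_mean G q r \<infinity> n (\<lambda>_. 1) = 1" for n
    using level_nonempty[OF root infinite_verts, of n] by (simp add: tree_mean_def image_constant_conv)
  have "tree_norm G q r \<infinity> (\<lambda>_. 1) = 1"
    unfolding tree_norm_def one by simp
  then have "(\<lambda>_. 1) \<in> T_space G q r \<infinity>" by (simp add: T_space_def)
  then show "\<psi> \<in> T_space G q r \<infinity>"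
    using C by (intro mem_spaces_dominated[of C \<psi> "\<lambda>_. 1" \<infinity>]) auto
next
  assume "\<psi> \<in> T_space G q r \<infinity>"
  then obtain B where B: "tree_norm G q r \<infinity> \<psi> = ennreal B" "0 \<le> B"
    by (cases "tree_norm G q r \<infinity> \<psi>") (auto simp: T_space_def)
  have "cmod (\<psi> v) \<le> B" if "v \<in> verts G" for v
  proof -
    have "ennreal (tree_mean G q r \<infinity> (depth G r v) \<psi>) \<le> ennreal B"
      unfolding B(1)[symmetric] tree_norm_def by (rule SUP_upper) simp
    then show ?thesis
      using B(2) cmod_le_tree_mean_infinity[OF that] order_trans by fastforce
  qed
  then show "bounded (\<psi> ` verts G)" unfolding bounded_iff by blast
qed

end

theorem theorem6:
  fixes T :: "('v, 'e) pre_digraph" and q :: nat and r :: 'v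
    and \<psi> :: "'v \<Rightarrow> complex" and p :: ennreal and X :: "('v \<Rightarrow> complex) set"
  assumes "q \<ge> 1"
    and "homogeneous_tree T q"
    and "infinite (verts T)"
    and "r \<in> verts T"
    and "0 < p"
    and "X = T_space T q r p \<or> X = T0_space T q r p \<or> X = Cc_space T q r p"
  shows "(bounded_operator_on X (tree_norm T q r p) (mult_op \<psi>) \<longleftrightarrow> bounded (\<psi> ` verts T))
    \<and> (bounded (\<psi> ` verts T) \<longleftrightarrow> \<psi> \<in> T_space T q r \<infinity>)"
proof -
  interpret rooted_homogeneous_tree T q r
    using assms by (simp add: rooted_homogeneous_tree_def rooted_homogeneous_tree_axioms_def)
  show ?thesis
    using bounded_operator_mult_op_iff[OF assms(5,6)] bounded_iff_T_space_infinity by blast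
qed

end
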